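(* Let $p$ be a prime and $q=p^f$ with $f\ge 2$. Let $\chi$ and $\chi'$ be multiplicative characters on $\mathbb{F}_q^\times$, with $\chi$ of order $q-1$. If $G(\chi)=G(\chi')$, then $\chi$ and $\chi'$ are Frobenius-conjugate.
   Context: Let $\mu_n$ denote the group of $n$-th roots of unity. Fix a generator $\zeta_p$ of $\mu_p$ and the additive character $\psi:\mathbb{F}_q\to\mu_p$, $\psi(a)=\zeta_p^{\operatorname{Tr}(a)}$, where $\operatorname{Tr}:\mathbb{F}_q\to\mathbb{F}_p$ is the trace. The Gauss sum of a multiplicative character $\chi:\mathbb{F}_q^\times\to\mu_{q-1}$ is $G(\chi)=\sum_{a\in\mathbb{F}_q^\times}\chi(a)\psi(a)\in\mathbb{Z}[\mu_{q-1},\mu_p]$. Two characters $\chi,\chi'$ are Frobenius-conjugate if $\chi'(a)=\chi(\sigma(a))$ for some $\sigma\in\operatorname{Gal}(\mathbb{F}_q/\mathbb{F}_p)$, i.e. $\chi'=\chi^{p^j}$ for some integer $j\ge 0$. *)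

theory Defs
  imports Complex_Main "HOL-Library.Cardinality" "HOL-Computational_Algebra.Computational_Algebra"
begin

text \<open>
  The field \<open>\<bbbF>\<^sub>q\<close> is a type \<open>'a\<close> of class \<open>finite_field\<close> with \<open>CARD('a) = q\<close>.
  Roots of unity are taken in the complex numbers.
\<close>

definition prime_subfield :: "'a :: finite_field set" where
  "prime_subfield = range of_nat"

definition galois_group :: "('a :: finite_field \<Rightarrow> 'a) set" where
  "galois_group = {\<sigma>. bij \<sigma> \<and> (\<forall>x y. \<sigma> (x + y) = \<sigma> x + \<sigma> y) \<and>
     (\<forall>x y. \<sigma> (x * y) = \<sigma> x * \<sigma> y) \<and> (\<forall>c\<in>prime_subfield. \<sigma> c = c)}"

text \<open>The extension is Galois, so its trace is the sum of the Galois conjugates.\<close>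

definition field_trace :: "'a :: finite_field \<Rightarrow> 'a" where
  "field_trace a = (\<Sum>\<sigma>\<in>galois_group. \<sigma> a)"

text \<open>
  An element of the prime subfield, read as a residue modulo \<open>p\<close>, is represented by a number
  in \<open>{0..<p}\<close>, so that it can be used as an exponent of a \<open>p\<close>-th root of unity.
\<close>

definition residue_rep :: "'a :: finite_field \<Rightarrow> nat" where
  "residue_rep c = (THE k. k < CHAR('a) \<and> of_nat k = c)"

definition roots_of_unity :: "nat \<Rightarrow> complex set" where
  "roots_of_unity n = {z. z ^ n = 1}"

definition generates_roots_of_unity :: "nat \<Rightarrow> complex \<Rightarrow> bool" where
  "generates_roots_of_unity n \<zeta> \<longleftrightarrow> roots_of_unity n = range (\<lambda>k::nat. \<zeta> ^ k)"

definition add_char :: "complex \<Rightarrow> 'a :: finite_field \<Rightarrow> complex" where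
  "add_char \<zeta> a = \<zeta> ^ residue_rep (field_trace a)"

text \<open>
  A multiplicative character is a homomorphism on the nonzero elements. It is represented by a
  total function whose value at \<open>0\<close> is arbitrary; no notion below depends on that value.
\<close>

definition mult_char :: "('a :: finite_field \<Rightarrow> complex) \<Rightarrow> bool" where
  "mult_char \<chi> \<longleftrightarrow> (\<forall>a. a \<noteq> 0 \<longrightarrow> \<chi> a \<in> roots_of_unity (CARD('a) - 1)) \<and>
     (\<forall>a b. a \<noteq> 0 \<longrightarrow> b \<noteq> 0 \<longrightarrow> \<chi> (a * b) = \<chi> a * \<chi> b)"

definition char_order :: "('a :: finite_field \<Rightarrow> complex) \<Rightarrow> nat" where
  "char_order \<chi> = (LEAST k. k > 0 \<and> (\<forall>a. a \<noteq> 0 \<longrightarrow> \<chi> a ^ k = 1))"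

definition gauss_sum :: "complex \<Rightarrow> ('a :: finite_field \<Rightarrow> complex) \<Rightarrow> complex" where
  "gauss_sum \<zeta> \<chi> = (\<Sum>a\<in>UNIV - {0}. \<chi> a * add_char \<zeta> a)"

definition frobenius_conjugate ::
    "('a :: finite_field \<Rightarrow> complex) \<Rightarrow> ('a \<Rightarrow> complex) \<Rightarrow> bool" where
  "frobenius_conjugate \<chi> \<chi>' \<longleftrightarrow> (\<exists>\<sigma>\<in>galois_group. \<forall>a. a \<noteq> 0 \<longrightarrow> \<chi>' a = \<chi> (\<sigma> a))"


lemma frobenius_in_galois_group: "(\<lambda>x::'a::finite_field. x ^ CHAR('a)) \<in> galois_group"
proof -
  let ?p = "CHAR('a)" and ?F = "\<lambda>x::'a. x ^ CHAR('a)"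
  have add: "?F (x + y) = ?F x + ?F y" for x y
    by (rule freshmans_dream) auto
  have "inj ?F"
  proof (rule injI)
    fix x y :: 'a assume "x ^ ?p = y ^ ?p"
    with add[of "x - y" y] have "(x - y) ^ ?p = 0" by simp
    then show "x = y" by simp
  qed
  then have "bij ?F" by (simp add: bij_def finite_UNIV_inj_surj)
  moreover have "(of_nat n :: 'a) ^ ?p = of_nat n" for n
    by (induction n) (simp_all add: add power_0_left)
  ultimately show ?thesis
    by (auto simp: galois_group_def prime_subfield_def add power_mult_distrib)
qed

lemma inj_on_of_nat_CHAR: "inj_on (of_nat :: nat \<Rightarrow> 'a :: finite_field) {..<CHAR('a)}"
proof (rule linorder_inj_onI')
  fix i j assume ij: "i \<in> {..<CHAR('a)}" "j \<in> {..<CHAR('a)}" "i < j"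
  show "(of_nat i :: 'a) \<noteq> of_nat j"
  proof
    assume "(of_nat i :: 'a) = of_nat j"
    with ij have "(of_nat (j - i) :: 'a) = 0" by (simp add: of_nat_diff)
    then have "CHAR('a) dvd j - i" by (simp only: of_nat_eq_0_iff_char_dvd)
    with ij show False by (auto dest: dvd_imp_le)
  qed
qed

lemma power_CHAR_eq_self_imp_prime_subfield:
  fixes x :: "'a :: finite_field"
  assumes "x ^ CHAR('a) = x"
  shows "x \<in> prime_subfield"
proof -
  let ?p = "CHAR('a)"
  let ?P = "monom (1::'a) ?p - monom 1 1"
  let ?R = "{x::'a. poly ?P x = 0}"
  have p1: "?p > 1" using prime_gt_1_nat[OF CHAR_prime] .
  have "coeff ?P ?p = 1" using p1 by simp
  then have nz: "?P \<noteq> 0" by (metis coeff_0 zero_neq_one)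
  have "degree ?P \<le> ?p"
    by (rule degree_diff_le) (use p1 in \<open>auto intro: order_trans[OF degree_monom_le]\<close>)
  then have card: "card ?R \<le> ?p" using card_poly_roots_bound[OF nz] by linarith
  note inj = inj_on_of_nat_CHAR[where ?'a = 'a]
  have fixed: "(of_nat n :: 'a) ^ ?p = of_nat n" for n
    using frobenius_in_galois_group by (auto simp: galois_group_def prime_subfield_def)
  have sub: "(of_nat :: nat \<Rightarrow> 'a) ` {..<?p} \<subseteq> ?R" by (auto simp: poly_monom fixed)
  have "(of_nat :: nat \<Rightarrow> 'a) ` {..<?p} = ?R"
    by (rule card_seteq[OF _ sub]) (use card inj in \<open>simp_all add: card_image\<close>)
  moreover have "x \<in> ?R" using assms by (simp add: poly_monom)
  ultimately show ?thesis by (auto simp: prime_subfield_def)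
qed

text \<open>The exponent in \<open>add_char\<close> is well defined.\<close>

lemma field_trace_in_prime_subfield: "field_trace a \<in> prime_subfield"
proof (rule power_CHAR_eq_self_imp_prime_subfield)
  let ?F = "\<lambda>x::'a. x ^ CHAR('a)"
  have inj: "inj_on ((\<circ>) ?F) galois_group"
  proof (rule inj_onI)
    fix \<sigma> \<tau> assume "?F \<circ> \<sigma> = ?F \<circ> \<tau>"
    moreover have "inj ?F" using frobenius_in_galois_group by (auto simp: galois_group_def bij_def)
    ultimately show "\<sigma> = \<tau>" by (metis fun.inj_map injD)
  qed
  have closed: "(\<circ>) ?F ` galois_group \<subseteq> galois_group"
    using frobenius_in_galois_group by (auto simp: galois_group_def bij_comp)
  have img: "(\<circ>) ?F ` galois_group = galois_group"
    by (rule endo_inj_surj[OF finite closed inj])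
  have "field_trace a ^ CHAR('a) = (\<Sum>\<sigma>\<in>galois_group. (?F \<circ> \<sigma>) a)"
    unfolding field_trace_def by (subst freshmans_dream_sum) auto
  also have "\<dots> = (\<Sum>\<sigma>\<in>(\<circ>) ?F ` galois_group. \<sigma> a)"
    by (simp add: sum.reindex[OF inj])
  also have "\<dots> = field_trace a" by (simp only: img field_trace_def)
  finally show "field_trace a ^ CHAR('a) = field_trace a" .
qed

lemma residue_rep:
  fixes c :: "'a :: finite_field"
  assumes "c \<in> prime_subfield"
  shows "residue_rep c < CHAR('a) \<and> of_nat (residue_rep c) = c"
  unfolding residue_rep_def
proof (rule theI')
  obtain n where n: "c = of_nat n" using assms by (auto simp: prime_subfield_def)
  have "(of_nat (n mod CHAR('a) + CHAR('a) * (n div CHAR('a))) :: 'a) = of_nat (n mod CHAR('a))"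
    by (simp only: of_nat_add of_nat_mult of_nat_CHAR) simp
  then have "(of_nat (n mod CHAR('a)) :: 'a) = c" by (simp add: n)
  moreover have "n mod CHAR('a) < CHAR('a)" by simp
  moreover have "k = l" if "k < CHAR('a) \<and> of_nat k = c" "l < CHAR('a) \<and> of_nat l = c" for k l
    using that inj_onD[OF inj_on_of_nat_CHAR[where ?'a = 'a], of k l] by auto
  ultimately show "\<exists>!k. k < CHAR('a) \<and> of_nat k = c" by metis
qed

end

theory Submission
  imports "HOL-Number_Theory.Residues" Defs
begin

text \<open>
  Let \<open>g\<close> generate \<open>\<bbbF>\<^sub>q\<^sup>\<times>\<close>. Then \<open>w = \<chi>(g)\<close> is a primitive root of unity of order \<open>q - 1\<close> and
  \<open>\<chi>'(g) = w\<^sup>b\<close>. Since \<open>\<zeta>\<close> has full degree over \<open>\<rat>(w)\<close>, equality of the Gauss sums forces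
  \<open>\<Sum>\<^bsub>Tr a = j\<^esub> \<chi>(a) = \<Sum>\<^bsub>Tr a = j\<^esub> \<chi>'(a)\<close> for every \<open>j\<close>. By irreducibility of the cyclotomic polynomial there
  is a ring homomorphism \<open>\<int>[w] \<rightarrow> \<bbbF>\<^sub>q\<close> with \<open>w \<mapsto> g\<inverse>\<close>, that is \<open>\<chi>(a) \<mapsto> a\<inverse>\<close>. Applying it, multiplying
  by \<open>j\<close> and summing over \<open>j\<close> gives \<open>\<Sum>\<^sub>a a\<^bsup>-b\<^esup> Tr a = \<Sum>\<^sub>a a\<inverse> Tr a = -1\<close>. Writing the trace as the sum
  of the conjugates \<open>\<sigma>(a)\<close>, some \<open>\<Sum>\<^sub>a a\<^bsup>-b\<^esup> \<sigma>(a)\<close> is nonzero, and orthogonality yields \<open>\<sigma>(a) = a\<^sup>b\<close>.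
\<close>

section \<open>Evaluation of integer polynomials\<close>

text \<open>Integer relations found at a complex root of unity are later read in characteristic p,
  so the argument ranges over any commutative ring.\<close>

definition int_poly_eval :: "int poly \<Rightarrow> 'a :: comm_ring_1 \<Rightarrow> 'a" where
  "int_poly_eval F x = poly (map_poly of_int F) x"

lemma int_poly_eval_0 [simp]: "int_poly_eval 0 x = 0"
  by (simp add: int_poly_eval_def)

lemma int_poly_eval_pCons [simp]: "int_poly_eval (pCons a F) x = of_int a + x * int_poly_eval F x"
  by (simp add: int_poly_eval_def map_poly_pCons)

lemma int_poly_eval_1 [simp]: "int_poly_eval 1 x = 1"
  by (simp add: int_poly_eval_def)

lemma int_poly_eval_monom [simp]: "int_poly_eval (monom a k) x = of_int a * x ^ k"
  by (simp add: int_poly_eval_def map_poly_monom poly_monom)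

lemma int_poly_eval_add [simp]: "int_poly_eval (F + G) x = int_poly_eval F x + int_poly_eval G x"
proof -
  have "map_poly (of_int :: int \<Rightarrow> 'a) (F + G) = map_poly of_int F + map_poly of_int G"
    by (intro poly_eqI) (simp add: coeff_map_poly)
  then show ?thesis by (simp add: int_poly_eval_def)
qed

lemma int_poly_eval_diff [simp]: "int_poly_eval (F - G) x = int_poly_eval F x - int_poly_eval G x"
proof -
  have "map_poly (of_int :: int \<Rightarrow> 'a) (F - G) = map_poly of_int F - map_poly of_int G"
    by (intro poly_eqI) (simp add: coeff_map_poly)
  then show ?thesis by (simp add: int_poly_eval_def)
qed

lemma int_poly_eval_smult [simp]: "int_poly_eval (smult a F) x = of_int a * int_poly_eval F x"
  by (simp add: int_poly_eval_def map_poly_smult)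

lemma int_poly_eval_mult [simp]: "int_poly_eval (F * G) x = int_poly_eval F x * int_poly_eval G x"
  by (induction F) (simp_all add: algebra_simps)

lemma int_poly_eval_power [simp]: "int_poly_eval (F ^ k) x = int_poly_eval F x ^ k"
  by (induction k) simp_all

lemma int_poly_eval_sum [simp]: "int_poly_eval (sum F A) x = (\<Sum>i\<in>A. int_poly_eval (F i) x)"
  by (induction A rule: infinite_finite_induct) simp_all

lemma int_poly_eval_prod [simp]: "int_poly_eval (prod F A) x = (\<Prod>i\<in>A. int_poly_eval (F i) x)"
  by (induction A rule: infinite_finite_induct) simp_all

lemma int_poly_eval_pcompose [simp]:
  "int_poly_eval (pcompose F G) x = int_poly_eval F (int_poly_eval G x)"
  by (induction F) (simp_all add: pcompose_pCons)

lemma int_poly_eval_eq_0_if_dvd: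
  assumes "F dvd G" "int_poly_eval F x = 0"
  shows "int_poly_eval G x = 0"
  using assms by (auto elim!: dvdE)

section \<open>Galois conjugation of roots of unity\<close>

text \<open>The inner binomial coefficients are divisible by \<open>l\<close>. The ring need not
  have characteristic \<open>l\<close>: the use below is in integer polynomials.\<close>

lemma prime_dvd_power_add_diff:
  fixes a b :: "'a :: comm_ring_1"
  assumes "prime l"
  shows "of_nat l dvd (a + b) ^ l - a ^ l - b ^ l"
proof -
  have l: "l > 0" using assms prime_gt_0_nat by blast
  have "{..l} = insert 0 (insert l {0<..<l})" using l by auto
  then have "(a + b) ^ l - a ^ l - b ^ l = (\<Sum>k\<in>{0<..<l}. of_nat (l choose k) * a ^ k * b ^ (l - k))"
    using l by (simp add: binomial_ring)
  moreover have "of_nat l dvd (of_nat (l choose k) :: 'a)" if "k \<in> {0<..<l}" for k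
  proof -
    have "l dvd (l choose k)" using that by (intro dvd_choose_prime[OF _ _ _ assms]) auto
    then show ?thesis by (elim dvdE) simp
  qed
  ultimately show ?thesis by (auto intro!: dvd_sum)
qed

lemma fermat_little_int:
  fixes a :: int
  assumes "prime l"
  shows "[a ^ l = a] (mod int l)"
proof -
  define c where "c = nat (a mod int l)"
  have "[c ^ l = c] (mod l)"
  proof (cases "l dvd c")
    case True
    then have "l dvd c ^ l" using assms by (simp add: prime_gt_0_nat dvd_power_iff dvd_trans)
    with True show ?thesis by (simp add: cong_def mod_eq_0_iff_dvd)
  next
    case False
    then have "[c ^ (l - 1) * c = 1 * c] (mod l)"
      using fermat_theorem[OF assms False] cong_scalar_right by blast
    then show ?thesis using assms by (metis mult_1 power_minus_mult prime_gt_0_nat)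
  qed
  then have "[int c ^ l = int c] (mod int l)" by (metis cong_int_iff of_nat_power)
  moreover have "int c = a mod int l"
    using assms prime_gt_0_nat[of l] by (simp add: c_def)
  ultimately show ?thesis by (simp add: cong_def power_mod)
qed

text \<open>Frobenius modulo \<open>l\<close>: splitting off the constant term, the power of the sum
  splits modulo \<open>l\<close>, and Fermat's little theorem fixes the constant.\<close>

lemma prime_dvd_power_diff_pcompose:
  fixes h :: "int poly"
  assumes "prime l"
  shows "[:int l:] dvd h ^ l - pcompose h (monom 1 l)"
proof (induction h)
  case 0
  show ?case using assms by (simp add: prime_gt_0_nat power_0_left)
next
  case (pCons a h)
  let ?X = "monom (1::int) 1"
  have l: "[:int l:] = of_nat l" by (simp add: of_nat_poly)
  have pc: "pCons a h = [:a:] + ?X * h" by (simp add: monom_altdef)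
  have 1: "[:int l:] dvd pCons a h ^ l - [:a:] ^ l - (?X * h) ^ l"
    unfolding l pc by (rule prime_dvd_power_add_diff[OF assms])
  have "[a ^ l = a] (mod int l)" by (rule fermat_little_int[OF assms])
  then have 2: "[:int l:] dvd [:a:] ^ l - [:a:]"
    by (simp add: cong_iff_dvd_diff poly_const_pow)
  have 3: "[:int l:] dvd monom 1 l * (h ^ l - pcompose h (monom 1 l))"
    using pCons.IH by (rule dvd_mult)
  have "(?X * h) ^ l = monom 1 l * h ^ l"
    by (simp add: power_mult_distrib monom_power)
  then have "pCons a h ^ l - pcompose (pCons a h) (monom 1 l) =
     (pCons a h ^ l - [:a:] ^ l - (?X * h) ^ l) + ([:a:] ^ l - [:a:])
       + monom 1 l * (h ^ l - pcompose h (monom 1 l))"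
    by (simp add: pcompose_pCons algebra_simps)
  then show ?case using 1 2 3 by (simp only: dvd_add)
qed

text \<open>Gauss's lemma: content is multiplicative, so \<open>a\<close> divides the content of the
  cofactor and cancels.\<close>

lemma primitive_dvd_smult_imp_dvd:
  fixes f G :: "int poly"
  assumes "content f = 1" "a \<noteq> 0" "f dvd smult a G"
  shows "f dvd G"
proof -
  obtain q where q: "smult a G = f * q" using assms(3) by (elim dvdE)
  have "content q = content (smult a G)" unfolding q content_mult using assms(1) by simp
  then have "a dvd content q" by simp
  then have "[:a:] dvd q" by (simp add: const_poly_dvd_iff_dvd_content)
  then obtain r where "q = smult a r" by (elim dvdE) simp
  with q have "smult a G = smult a (f * r)" by simp
  with assms(2) have "G = f * r" by (metis smult_cancel)
  then show ?thesis by simp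
qed

text \<open>Take the primitive part of an annihilator of least degree. Pseudo-division leaves a
  smaller annihilator, hence 0; primitivity then removes the multiplier, giving divisibility over
  the integers.\<close>

lemma primitive_minimal_polynomial_exists:
  fixes w :: complex and M :: "int poly"
  assumes "int_poly_eval M w = 0" "M \<noteq> 0"
  obtains f where "f \<noteq> 0" "int_poly_eval f w = 0"
    "\<And>G. int_poly_eval G w = 0 \<Longrightarrow> f dvd G"
    "\<And>G. int_poly_eval G w = 0 \<Longrightarrow> degree G < degree f \<Longrightarrow> G = 0"
proof -
  obtain f0 where f0: "f0 \<noteq> 0" "int_poly_eval f0 w = 0"
    "\<And>G. G \<noteq> 0 \<and> int_poly_eval G w = 0 \<Longrightarrow> degree f0 \<le> degree G"
    using ex_has_least_nat[of "\<lambda>G. G \<noteq> 0 \<and> int_poly_eval G w = 0" M degree] assms by blast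
  define f where "f = primitive_part f0"
  have f0f: "f0 = smult (content f0) f" by (simp add: f_def)
  have c: "content f = 1" using f0(1) by (simp add: f_def)
  have deg: "degree f = degree f0" by (simp add: f_def)
  have nz: "f \<noteq> 0" using f0(1) f0f by auto
  have "of_int (content f0) * int_poly_eval f w = 0" by (metis f0(2) f0f int_poly_eval_smult)
  then have ev: "int_poly_eval f w = 0" using f0(1) by simp
  have small: "G = 0" if "int_poly_eval G w = 0" "degree G < degree f" for G
    using f0(3)[of G] that deg by force
  have "f dvd G" if G: "int_poly_eval G w = 0" for G
  proof -
    obtain a q where aq: "a \<noteq> 0" "smult a G = f * q + pseudo_mod G f"
      using pseudo_mod(1)[OF nz, of G] by blast
    have "int_poly_eval (smult a G) w = int_poly_eval (f * q + pseudo_mod G f) w"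
      by (simp only: aq(2))
    then have "int_poly_eval (pseudo_mod G f) w = 0" by (simp add: G ev)
    then have "pseudo_mod G f = 0" using pseudo_mod(2)[OF nz, of G] small by blast
    then have "f dvd smult a G" using aq(2) by simp
    then show ?thesis using primitive_dvd_smult_imp_dvd[OF c aq(1)] by blast
  qed
  then show ?thesis using that nz ev small by blast
qed

text \<open>
  Dedekind's argument: if \<open>w\<^sup>l\<close> is not a root of the minimal polynomial \<open>f\<close> of \<open>w\<close>, it is a root
  of the cofactor \<open>h\<close> of \<open>f\<close> in \<open>X\<^sup>n - 1\<close>, so that \<open>l\<close> divides \<open>h(w)\<^sup>l\<close>, hence also the \<open>l\<close>-th
  power of \<open>n w\<^bsup>n-1\<^esup> = f'(w) h(w)\<close>.
\<close>

lemma int_poly_eval_root_of_unity_power_prime: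
  fixes w :: complex
  assumes "prime l" "\<not> l dvd n" "w ^ n = 1" "int_poly_eval F w = 0"
  shows "int_poly_eval F (w ^ l) = 0"
proof -
  have n: "n > 0" using assms(2) by (cases n) auto
  let ?M = "monom (1::int) n - 1"
  have "coeff ?M n = 1" using n by simp
  then have "?M \<noteq> 0" by (metis coeff_0 zero_neq_one)
  then obtain f where f: "f \<noteq> 0" "int_poly_eval f w = 0"
    "\<And>G. int_poly_eval G w = 0 \<Longrightarrow> f dvd G"
    "\<And>G. int_poly_eval G w = 0 \<Longrightarrow> degree G < degree f \<Longrightarrow> G = 0"
    using primitive_minimal_polynomial_exists[of ?M w] assms(3) by auto
  obtain h where h: "?M = f * h" using f(3)[of ?M] assms(3) by (auto elim: dvdE)
  have "int_poly_eval f (w ^ l) * int_poly_eval h (w ^ l) = int_poly_eval ?M (w ^ l)"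
    by (simp only: h int_poly_eval_mult)
  also have "(w ^ l) ^ n = 1" using assms(3) by (metis power_mult mult.commute power_one)
  then have "int_poly_eval ?M (w ^ l) = 0" by simp
  finally consider "int_poly_eval f (w ^ l) = 0" | "int_poly_eval h (w ^ l) = 0" by auto
  then show ?thesis
  proof cases
    case 1
    then show ?thesis using f(3)[OF assms(4)] int_poly_eval_eq_0_if_dvd by blast
  next
    case 2
    obtain E where E: "h ^ l - pcompose h (monom 1 l) = [:int l:] * E"
      using prime_dvd_power_diff_pcompose[OF assms(1), of h] by (elim dvdE)
    have "int_poly_eval (h ^ l - pcompose h (monom 1 l)) w = int_poly_eval ([:int l:] * E) w"
      by (simp only: E)
    then have hl: "int_poly_eval h w ^ l = of_nat l * int_poly_eval E w" using 2 by simp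
    \<comment> \<open>Raising n = w h(w) f'(w) to the power \<open>l\<close> and inserting h(w)^l =
      l E(w) gives n^l = l B(w).\<close>
    define B where "B = monom 1 l * (pderiv f ^ l * E)"
    have "pderiv ?M = pderiv (f * h)" by (simp only: h)
    then have "monom (of_nat n) (n - 1) = f * pderiv h + h * pderiv f"
      by (simp add: pderiv_diff pderiv_monom pderiv_mult)
    then have "int_poly_eval (monom (of_nat n) (n - 1)) w = int_poly_eval (f * pderiv h + h * pderiv f) w"
      by (simp only:)
    then have "of_nat n * w ^ (n - 1) = int_poly_eval h w * int_poly_eval (pderiv f) w"
      by (simp add: f(2))
    moreover have "w * w ^ (n - 1) = 1" using n assms(3) by (metis power_eq_if not_gr0)
    ultimately have "of_nat n = w * (int_poly_eval h w * int_poly_eval (pderiv f) w)"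
      by (metis mult.left_commute mult.right_neutral)
    then have "of_nat n ^ l = (w * (int_poly_eval h w * int_poly_eval (pderiv f) w)) ^ l"
      by simp
    then have nl: "of_nat n ^ l = of_nat l * int_poly_eval B w"
      by (simp add: power_mult_distrib hl B_def mult_ac)
    obtain q r where qr: "pseudo_divmod B f = (q, r)" by (cases "pseudo_divmod B f")
    \<comment> \<open>The multiplier of pseudo-division. It is a unit, since \<open>f\<close>
      divides a monic polynomial.\<close>
    define c where "c = lead_coeff f ^ (Suc (degree B) - degree f)"
    have r: "smult c B = f * q + r" "r = 0 \<or> degree r < degree f"
      unfolding c_def using pseudo_divmod[OF f(1) qr] by auto
    have "degree f \<noteq> 0"
    proof
      assume "degree f = 0"
      then obtain c where "f = [:c:]" by (elim degree_eq_zeroE)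
      then show False using f(1,2) by simp
    qed
    have "int_poly_eval (smult c B) w = int_poly_eval (f * q + r) w" by (simp only: r)
    then have rw: "of_int c * int_poly_eval B w = int_poly_eval r w" by (simp add: f(2))
    \<comment> \<open>An annihilator of \<open>w\<close> of degree below that of \<open>f\<close>,
      hence zero; its constant coefficient shows that \<open>l\<close> divides c n^l.\<close>
    let ?D = "[:c * int n ^ l:] - smult (int l) r"
    have "int_poly_eval ?D w = of_int c * of_nat n ^ l - of_nat l * (of_int c * int_poly_eval B w)"
      by (simp add: rw)
    also have "\<dots> = 0" by (simp add: nl)
    finally have "int_poly_eval ?D w = 0" .
    moreover have "degree ?D < degree f" using \<open>degree f \<noteq> 0\<close> r(2)
      by (intro degree_diff_less) auto
    ultimately have "?D = 0" using f(4) by blast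
    then have "coeff ?D 0 = 0" by (metis coeff_0)
    then have ldvd: "int l dvd c * int n ^ l" by simp
    have "lead_coeff f * lead_coeff h = lead_coeff ?M" by (simp only: h lead_coeff_mult)
    also have "degree ?M = n"
    proof (rule antisym)
      show "degree ?M \<le> n" by (rule degree_diff_le) (auto simp: degree_monom_le)
      show "n \<le> degree ?M" using n by (intro le_degree) simp
    qed
    then have "lead_coeff ?M = 1" using n by simp
    finally have "is_unit (lead_coeff f)" by (metis dvd_triv_left)
    then have "is_unit c" by (simp only: c_def is_unit_power_iff simp_thms)
    then have "int l dvd int n ^ l" using ldvd by (metis dvd_mult_unit_iff' mult.commute)
    then have "l dvd n ^ l" by (metis int_dvd_int_iff of_nat_power)
    then show ?thesis using assms(1,2) prime_dvd_power by blast
  qed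
qed

text \<open>Split off one prime factor of \<open>l\<close> at a time; each intermediate power of
  \<open>w\<close> is again an \<open>n\<close>-th root of unity.\<close>

lemma int_poly_eval_root_of_unity_power_coprime:
  fixes w :: complex
  assumes "coprime l n" "n > 0" "w ^ n = 1" "int_poly_eval F w = 0"
  shows "int_poly_eval F (w ^ l) = 0"
  using assms(1)
proof (induction l rule: less_induct)
  case (less l)
  consider "l = 0" | "l = 1" | "l > 1" by linarith
  then show ?case
  proof cases
    \<comment> \<open>Coprimality with 0 forces n = 1, so w = 1.\<close>
    case 1
    then show ?thesis using less.prems assms by simp
  next
    case 2
    then show ?thesis using assms by simp
  next
    case 3
    then obtain r where r: "prime r" "r dvd l" using prime_factor_nat[of l] by auto
    then obtain m where m: "l = r * m" by (elim dvdE)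
    have "m < l" "coprime m n" "coprime r n"
      using m 3 less.prems prime_gt_1_nat[OF r(1)] by (auto intro!: Nat.gr0I)
    then have "int_poly_eval F (w ^ m) = 0" using less.IH by blast
    moreover have "(w ^ m) ^ n = 1" using assms(3) by (metis power_mult mult.commute power_one)
    moreover have "\<not> r dvd n" using \<open>coprime r n\<close> r(1)
      by (metis coprime_absorb_left not_prime_unit)
    ultimately have "int_poly_eval F ((w ^ m) ^ r) = 0"
      using int_poly_eval_root_of_unity_power_prime[OF r(1)] by blast
    then show ?thesis by (simp add: m mult.commute flip: power_mult)
  qed
qed

section \<open>Elements of exact order and reduction of roots of unity\<close>

text \<open>The divisibility form lets exponents be handled modulo \<open>n\<close>, for complex
  numbers and finite field elements alike.\<close>

definition has_mult_order :: "nat \<Rightarrow> 'a :: monoid_mult \<Rightarrow> bool" where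
  "has_mult_order n x \<longleftrightarrow> (\<forall>k. x ^ k = 1 \<longleftrightarrow> n dvd k)"

lemma has_mult_order_power_eq_1_iff: "has_mult_order n x \<Longrightarrow> x ^ k = 1 \<longleftrightarrow> n dvd k"
  by (simp add: has_mult_order_def)

lemma has_mult_order_power_cong:
  assumes "has_mult_order n x" "[j = k] (mod n)"
  shows "x ^ j = x ^ k"
proof -
  have "x ^ i = x ^ (i mod n)" for i
  proof -
    have "x ^ i = x ^ (n * (i div n) + i mod n)" by simp
    moreover have "x ^ (n * (i div n)) = 1"
      using has_mult_order_power_eq_1_iff[OF assms(1)] dvd_triv_left by blast
    ultimately show ?thesis by (simp only: power_add mult_1)
  qed
  then show ?thesis using assms(2) by (metis cong_def)
qed

lemma has_mult_orderI:
  assumes "x ^ n = 1" "\<And>k. 0 < k \<Longrightarrow> k < n \<Longrightarrow> x ^ k \<noteq> 1" "n > 0"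
  shows "has_mult_order n x"
  unfolding has_mult_order_def
proof (intro allI)
  fix k
  have "x ^ k = x ^ (n * (k div n) + k mod n)" by simp
  also have "\<dots> = x ^ (k mod n)" unfolding power_add power_mult assms(1) by simp
  finally show "x ^ k = 1 \<longleftrightarrow> n dvd k"
    using assms(2)[of "k mod n"] assms(3) by (auto simp: dvd_eq_mod_eq_0)
qed

lemma has_mult_order_inj_on:
  fixes w :: "'a :: field"
  assumes "has_mult_order n w" "n > 0"
  shows "inj_on ((^) w) {..<n}"
proof (rule linorder_inj_onI')
  fix i j assume ij: "i \<in> {..<n}" "j \<in> {..<n}" "i < j"
  have "w \<noteq> 0" using has_mult_order_power_eq_1_iff[OF assms(1), of n] assms(2)
    by (metis dvd_refl power_0_left not_gr_zero zero_neq_one)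
  show "w ^ i \<noteq> w ^ j"
  proof
    assume "w ^ i = w ^ j"
    also have "\<dots> = w ^ i * w ^ (j - i)" using ij by (simp flip: power_add)
    finally have "w ^ (j - i) = 1" using \<open>w \<noteq> 0\<close> by simp
    then have "n dvd j - i" using assms(1) by (simp add: has_mult_order_power_eq_1_iff)
    then show False using ij by (auto dest: dvd_imp_le)
  qed
qed

text \<open>
  So there is a ring homomorphism \<open>\<int>[w] \<rightarrow> 'a\<close> with \<open>w \<mapsto> g\<close>. The product \<open>D\<close> below takes care of
  the \<open>n\<close>-th roots of unity of smaller order, at which \<open>F\<close> need not vanish.
\<close>

lemma int_poly_eval_transfer:
  fixes w :: complex and g :: "'a :: idom"
  assumes w: "has_mult_order n w" and g: "has_mult_order n g" and n: "n > 0"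
    and F: "int_poly_eval F w = 0"
  shows "int_poly_eval F g = 0"
proof -
  define D where "D = (\<Prod>d\<in>{0<..<n}. monom (1::int) d - 1)"
  define M where "M = monom (1::int) n - 1"
  have wn: "w ^ n = 1" and gn: "g ^ n = 1"
    using w g by (simp_all add: has_mult_order_power_eq_1_iff)
  have roots: "int_poly_eval (F * D) (w ^ j) = 0" for j
  proof (cases "coprime j n")
    case True
    then show ?thesis using int_poly_eval_root_of_unity_power_coprime[OF True n wn F] by simp
  next
    case False
    \<comment> \<open>The order of \<open>w ^ j\<close> divides this proper divisor of
      \<open>n\<close>, so the factor X^d - 1 of \<open>D\<close> vanishes there.\<close>
    define d where "d = n div gcd j n"
    have "gcd j n \<noteq> 1" using False by (simp add: coprime_iff_gcd_eq_1)
    then have "gcd j n > 1" using n by (metis One_nat_def Suc_lessI gcd_pos_nat not_gr0)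
    then have d: "d \<in> {0<..<n}" using n by (auto simp: d_def div_greater_zero_iff intro: gcd_le2_nat)
    have "j * d = (j div gcd j n) * n"
      by (simp add: d_def) (metis div_mult_swap dvd_div_mult gcd_dvd1 gcd_dvd2 mult.commute)
    then have "(w ^ j) ^ d = 1"
      using w by (simp add: has_mult_order_power_eq_1_iff flip: power_mult)
    then have "int_poly_eval D (w ^ j) = 0"
      unfolding D_def int_poly_eval_prod using d by (intro prod_zero) auto
    then show ?thesis by simp
  qed
  have degM: "degree M = n" unfolding M_def
  proof (rule antisym)
    show "degree (monom (1::int) n - 1) \<le> n"
      by (rule degree_diff_le) (auto simp: degree_monom_le)
    show "n \<le> degree (monom (1::int) n - 1)" using n by (intro le_degree) simp
  qed
  then have lc: "lead_coeff M = 1" using n by (simp add: M_def)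
  then have "M \<noteq> 0" by auto
  obtain q r where qr: "pseudo_divmod (F * D) M = (q, r)" by (cases "pseudo_divmod (F * D) M")
  have r: "F * D = M * q + r" "r = 0 \<or> degree r < n"
    using pseudo_divmod[OF \<open>M \<noteq> 0\<close> qr] lc degM by auto
  \<comment> \<open>Otherwise \<open>r\<close>, of degree below \<open>n\<close>, would have the
    \<open>n\<close> distinct powers of \<open>w\<close> as roots.\<close>
  have "r = 0"
  proof (rule ccontr)
    assume nz: "r \<noteq> 0"
    let ?r = "map_poly complex_of_int r"
    have deg: "degree ?r < n" using nz r(2) by (simp add: degree_map_poly)
    have nz': "?r \<noteq> 0" using nz by (simp add: map_poly_eq_0_iff)
    have "int_poly_eval r (w ^ j) = 0" for j
    proof -
      have "int_poly_eval (F * D) (w ^ j) = int_poly_eval (M * q + r) (w ^ j)" by (simp only: r)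
      moreover have "(w ^ j) ^ n = 1" using wn by (metis power_mult mult.commute power_one)
      ultimately show ?thesis unfolding roots by (simp add: M_def)
    qed
    then have "(^) w ` {..<n} \<subseteq> {x. poly ?r x = 0}" by (auto simp: int_poly_eval_def)
    then have "card ((^) w ` {..<n}) \<le> card {x. poly ?r x = 0}"
      by (intro card_mono poly_roots_finite nz')
    also have "\<dots> \<le> degree ?r" by (rule card_poly_roots_bound[OF nz'])
    finally show False using deg has_mult_order_inj_on[OF w n] by (simp add: card_image)
  qed
  then have "int_poly_eval (F * D) g = 0" using r(1) gn by (simp add: M_def)
  \<comment> \<open>The exact order of \<open>g\<close> keeps every factor of \<open>D\<close>
    nonzero at \<open>g\<close>, so \<open>D\<close> cancels in the integral domain.\<close>
  moreover have "int_poly_eval D g \<noteq> 0"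
    unfolding D_def int_poly_eval_prod
    using g by (auto simp: has_mult_order_power_eq_1_iff dest: dvd_imp_le)
  ultimately show ?thesis by simp
qed

section \<open>Characters of finite fields\<close>

text \<open>The type is repackaged as a ring record, for which cyclicity of the unit group is a
  known theorem.\<close>

lemma finite_field_mult_group_cyclic:
  obtains g :: "'a :: finite_field" where "g \<noteq> 0" "\<And>a. a \<noteq> 0 \<Longrightarrow> \<exists>i. a = g ^ i"
proof -
  define R where "R = (\<lparr>carrier = (UNIV :: 'a set), monoid.mult = (*), one = 1, ring.zero = 0, add = (+)\<rparr> :: 'a ring)"
  have "cring R"
  proof (rule cringI)
    show "abelian_group R"
    proof (rule abelian_groupI)
      fix x assume "x \<in> carrier R"
      show "\<exists>y\<in>carrier R. y \<oplus>\<^bsub>R\<^esub> x = \<zero>\<^bsub>R\<^esub>"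
        by (rule bexI[of _ "- x"]) (simp_all add: R_def)
    qed (simp_all add: R_def add_ac)
    show "Group.comm_monoid R"
      by (rule comm_monoidI) (simp_all add: R_def mult_ac)
  qed (simp_all add: R_def algebra_simps)
  then interpret cring R .
  have "Units R = carrier R - {\<zero>\<^bsub>R\<^esub>}"
  proof -
    have "x \<noteq> 0 \<Longrightarrow> \<exists>y. y * x = 1 \<and> x * y = 1" for x :: 'a
      by (rule exI[of _ "inverse x"]) simp
    then show ?thesis by (force simp: Units_def R_def)
  qed
  then interpret field R by (rule cring_fieldI)
  have pow: "x [^]\<^bsub>R\<^esub> i = x ^ i" for x :: 'a and i :: nat
    by (induction i) (simp_all add: R_def nat_pow_def mult.commute)
  have "finite (carrier R)" by (simp add: R_def)
  from finite_field_mult_group_has_gen[OF this] obtain g where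
    g: "g \<in> carrier (mult_of R)" "carrier (mult_of R) = {g [^]\<^bsub>R\<^esub> i | i::nat. i \<in> UNIV}"
    by blast
  have c: "carrier (mult_of R) = UNIV - {0}" by (simp add: R_def)
  show ?thesis using g that[of g] unfolding c pow by blast
qed

lemma has_mult_order_generator:
  fixes g :: "'a :: finite_field"
  assumes "g \<noteq> 0" "\<And>a. a \<noteq> 0 \<Longrightarrow> \<exists>i. a = g ^ i"
  shows "has_mult_order (CARD('a) - 1) g"
proof (rule has_mult_orderI)
  have card1: "CARD('a) > 1"
    using card_mono[of "UNIV :: 'a set" "{0, 1}"] by simp
  then show "CARD('a) - 1 > 0" by simp
  have "g * g ^ (CARD('a) - 1) = g * 1"
    using finite_field_power_card_eq_same[of g] card1 by (simp flip: power_Suc)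
  then show "g ^ (CARD('a) - 1) = 1" using assms(1) by simp
  fix k assume k: "0 < k" "k < CARD('a) - 1"
  show "g ^ k \<noteq> 1"
  proof
    assume gk: "g ^ k = 1"
    have "UNIV - {0} \<subseteq> (^) g ` {..<k}"
    proof
      fix a assume "a \<in> UNIV - {0 :: 'a}"
      then obtain i where "a = g ^ i" using assms(2) by blast
      also have "\<dots> = g ^ (k * (i div k) + i mod k)" by simp
      also have "\<dots> = g ^ (i mod k)" unfolding power_add power_mult gk by simp
      finally show "a \<in> (^) g ` {..<k}" using k by auto
    qed
    then have "card (UNIV - {0 :: 'a}) \<le> card ((^) g ` {..<k})" by (intro card_mono) auto
    also have "\<dots> \<le> k" using card_image_le[of "{..<k}"] by simp
    finally show False using k by (simp add: card_Diff_singleton)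
  qed
qed

text \<open>Substituting \<open>c * a\<close> for \<open>a\<close> multiplies the sum by
  \<open>h c\<close>. It serves both complex characters and maps into the finite field
  itself.\<close>

lemma sum_nontrivial_hom_eq_0:
  fixes h :: "'a :: finite_field \<Rightarrow> 'b :: idom"
  assumes "\<And>a b. a \<noteq> 0 \<Longrightarrow> b \<noteq> 0 \<Longrightarrow> h (a * b) = h a * h b" and "c \<noteq> 0" "h c \<noteq> 1"
  shows "(\<Sum>a\<in>UNIV - {0}. h a) = 0"
proof -
  have "(\<Sum>a\<in>UNIV - {0}. h a) = (\<Sum>a\<in>UNIV - {0}. h (c * a))"
    by (rule sum.reindex_bij_witness[of _ "\<lambda>a. c * a" "\<lambda>a. a / c"]) (use assms(2) in auto)
  also have "\<dots> = h c * (\<Sum>a\<in>UNIV - {0}. h a)"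
    unfolding sum_distrib_left by (rule sum.cong) (use assms in auto)
  finally show ?thesis using assms(3) by (simp add: mult_cancel_right1)
qed

lemma CHAR_eq_if_CARD_prime_power:
  assumes "prime p" "CARD('a :: finite_field) = p ^ f"
  shows "CHAR('a) = p"
proof -
  have "CHAR('a) dvd p ^ f" using CHAR_dvd_CARD[where ?'a = 'a] assms(2) by simp
  moreover have "prime CHAR('a)" by (rule CHAR_prime)
  ultimately have "CHAR('a) dvd p" using prime_dvd_power by blast
  then show ?thesis using assms(1) \<open>prime CHAR('a)\<close> primes_dvd_imp_eq by blast
qed

text \<open>If \<zeta>^k = 1 with \<open>k\<close> prime to \<open>p\<close>, Bezout gives \<zeta> =
  1, which generates only one of the \<open>p\<close> roots.\<close>

lemma has_mult_order_if_generates_roots_of_unity: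
  assumes "prime p" "generates_roots_of_unity p \<zeta>"
  shows "has_mult_order p \<zeta>"
  unfolding has_mult_order_def
proof (intro allI)
  fix k
  have p: "p > 1" using assms(1) prime_gt_1_nat by blast
  have "\<zeta> ^ 1 \<in> roots_of_unity p"
    using assms(2) unfolding generates_roots_of_unity_def by blast
  then have zp: "\<zeta> ^ p = 1" by (simp add: roots_of_unity_def)
  show "\<zeta> ^ k = 1 \<longleftrightarrow> p dvd k"
  proof
    assume k: "\<zeta> ^ k = 1"
    show "p dvd k"
    proof (rule ccontr)
      assume "\<not> p dvd k"
      then have "coprime k p" using assms(1) by (metis coprime_commute prime_imp_coprime)
      then obtain x y where "k * x = p * y + 1"
        using p by (metis coprime_bezout_strong less_not_refl)
      then have "\<zeta> ^ (k * x) = \<zeta> ^ (p * y + 1)" by simp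
      then have "\<zeta> = 1" by (simp add: power_add power_mult k zp)
      then have "roots_of_unity p = {1}"
        using assms(2) by (simp add: generates_roots_of_unity_def)
      moreover have "card (roots_of_unity p) = p"
        unfolding roots_of_unity_def by (rule card_roots_unity_eq) (use p in simp)
      ultimately show False using p by simp
    qed
  qed (auto elim!: dvdE simp: power_mult zp)
qed

section \<open>Fourier inversion modulo p\<close>

lemma sum_powers_root_of_unity:
  fixes z :: complex
  assumes "z ^ p = 1"
  shows "(\<Sum>i<p. z ^ i) = (if z = 1 then of_nat p else 0)"
  using assms by (simp add: sum_gp_strict)

text \<open>
  The relation \<open>\<Sum>\<^sub>k c\<^sub>k \<zeta>\<^sup>k = 0\<close> with \<open>c\<^sub>k \<in> \<int>[w]\<close> is preserved by the conjugations
  \<open>\<zeta> \<mapsto> \<zeta>\<^sup>i\<close> fixing \<open>w\<close>; Fourier inversion on \<open>\<int>/p\<close> then shows that \<open>c\<^sub>k\<close> is constant in \<open>k\<close>.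
\<close>

lemma fibre_sums_eq_if_weighted_sum_eq_0:
  fixes w \<zeta> :: complex and e e' r :: "'c \<Rightarrow> nat"
  assumes w: "has_mult_order n w" "n > 0" and \<zeta>: "has_mult_order p \<zeta>" "prime p"
    and np: "coprime n p"
    and A: "finite A" and r: "\<And>a. a \<in> A \<Longrightarrow> r a < p"
    and eq: "(\<Sum>a\<in>A. (w ^ e a - w ^ e' a) * \<zeta> ^ r a) = 0" and j: "j < p"
  shows "of_nat p * (\<Sum>a\<in>{a\<in>A. r a = j}. w ^ e a - w ^ e' a) = (\<Sum>a\<in>A. w ^ e a - w ^ e' a)"
proof -
  have p: "p > 0" using \<zeta>(2) prime_gt_0_nat by blast
  \<comment> \<open>Chinese remainder idempotents: z^u = w and z^v = \<zeta> for z = w \<zeta>, so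
    the weighted sum is an integer polynomial in the single root of unity \<open>z\<close>.\<close>
  obtain u where u: "[u = 1] (mod n)" "[u = 0] (mod p)"
    using binary_chinese_remainder_nat[OF np] by blast
  obtain v where v: "[v = 0] (mod n)" "[v = 1] (mod p)"
    using binary_chinese_remainder_nat[OF np] by blast
  define z where "z = w * \<zeta>"
  define F where "F = (\<Sum>a\<in>A. monom (1::int) (u * e a + v * r a) - monom 1 (u * e' a + v * r a))"
  have eval: "int_poly_eval F (z ^ l) = (\<Sum>a\<in>A. (w ^ e a - w ^ e' a) * (\<zeta> ^ r a) ^ i)"
    if l: "[l = 1] (mod n)" "[l = i] (mod p)" for l i
  proof -
    have c: "[l * u = 1 * 1] (mod n)" "[l * u = i * 0] (mod p)"
      "[l * v = 1 * 0] (mod n)" "[l * v = i * 1] (mod p)"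
      by (intro cong_mult l u v)+
    note has_mult_order_power_cong[OF w(1) c(1)] has_mult_order_power_cong[OF \<zeta>(1) c(2)]
      has_mult_order_power_cong[OF w(1) c(3)] has_mult_order_power_cong[OF \<zeta>(1) c(4)]
    then have "z ^ (l * u) = w" "z ^ (l * v) = \<zeta> ^ i"
      unfolding z_def power_mult_distrib by simp_all
    then have "(z ^ l) ^ (u * b + v * c) = w ^ b * (\<zeta> ^ c) ^ i" for b c
      unfolding power_add by (metis power_mult mult.assoc mult.commute)
    then show ?thesis unfolding F_def by (simp add: left_diff_distrib)
  qed
  have conj: "(\<Sum>a\<in>A. (w ^ e a - w ^ e' a) * (\<zeta> ^ r a) ^ i) = 0" if i: "i \<in> {1..<p}" for i
  proof -
    \<comment> \<open>Raising \<open>z\<close> to this power fixes \<open>w\<close> and sends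
      \<zeta> to \<zeta>^i; \<open>l\<close> is prime to both \<open>n\<close> and
      \<open>p\<close>.\<close>
    obtain l where l: "[l = 1] (mod n)" "[l = i] (mod p)"
      using binary_chinese_remainder_nat[OF np] by blast
    have "coprime i p" using i \<zeta>(2)
      by (metis atLeastLessThan_iff coprime_commute nat_dvd_not_less not_one_le_zero not_gr0 prime_imp_coprime)
    then have "coprime l p" using l(2) cong_imp_coprime cong_sym by blast
    moreover have "coprime l n" using l(1) cong_imp_coprime[of 1 l n] cong_sym by auto
    ultimately have "coprime l (n * p)" by simp
    moreover have "n * p > 0" using w(2) p by simp
    moreover have "w ^ (n * p) = 1" "\<zeta> ^ (n * p) = 1"
      by (simp_all add: has_mult_order_power_eq_1_iff[OF w(1)] has_mult_order_power_eq_1_iff[OF \<zeta>(1)])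
    then have "z ^ (n * p) = 1" by (simp add: z_def power_mult_distrib)
    moreover have "int_poly_eval F z = 0" using eval[of 1 1] eq by simp
    ultimately have "int_poly_eval F (z ^ l) = 0"
      using int_poly_eval_root_of_unity_power_coprime by blast
    then show ?thesis using eval[OF l] by simp
  qed
  \<comment> \<open>Orthogonality detects \<open>r a = j\<close>; the exponent \<open>p - j\<close>
    stands for -j among the naturals.\<close>
  have orth: "(\<Sum>i<p. (\<zeta> ^ (r a + (p - j))) ^ i) = (if r a = j then of_nat p else 0)" if "a \<in> A" for a
  proof -
    have "(\<zeta> ^ (r a + (p - j))) ^ p = 1"
      using has_mult_order_power_eq_1_iff[OF \<zeta>(1)] by (simp flip: power_mult)
    moreover have "\<zeta> ^ (r a + (p - j)) = 1 \<longleftrightarrow> r a = j"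
    proof -
      have "p dvd r a + (p - j) \<longleftrightarrow> r a = j"
      proof
        assume "p dvd r a + (p - j)"
        then obtain k where k: "r a + (p - j) = p * k" by (elim dvdE)
        have "0 < p * k" "p * k < p * 2" using r[OF that] j k by linarith+
        then have "k = 1" by simp
        then show "r a = j" using k j by simp
      qed (use j in simp)
      then show ?thesis using has_mult_order_power_eq_1_iff[OF \<zeta>(1)] by simp
    qed
    ultimately show ?thesis using sum_powers_root_of_unity by metis
  qed
  have "of_nat p * (\<Sum>a\<in>{a\<in>A. r a = j}. w ^ e a - w ^ e' a)
      = (\<Sum>a\<in>A. if r a = j then of_nat p * (w ^ e a - w ^ e' a) else 0)"
    unfolding sum_distrib_left by (rule sum.inter_filter[OF A])
  also have "\<dots> = (\<Sum>a\<in>A. (w ^ e a - w ^ e' a) * (\<Sum>i<p. (\<zeta> ^ (r a + (p - j))) ^ i))"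
    by (rule sum.cong) (auto simp: orth)
  also have "\<dots> = (\<Sum>i<p. \<Sum>a\<in>A. (w ^ e a - w ^ e' a) * (\<zeta> ^ (r a + (p - j))) ^ i)"
    unfolding sum_distrib_left by (rule sum.swap)
  also have "\<dots> = (\<Sum>i<p. (\<zeta> ^ (p - j)) ^ i * (\<Sum>a\<in>A. (w ^ e a - w ^ e' a) * (\<zeta> ^ r a) ^ i))"
    unfolding sum_distrib_left by (simp add: power_add power_mult_distrib mult_ac)
  \<comment> \<open>By \<open>conj\<close> only the trivial frequency survives, which makes the
    result independent of \<open>j\<close>.\<close>
  also have "\<dots> = (\<Sum>i\<in>{0}. (\<zeta> ^ (p - j)) ^ i * (\<Sum>a\<in>A. (w ^ e a - w ^ e' a) * (\<zeta> ^ r a) ^ i))"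
    by (rule sum.mono_neutral_right) (use p in \<open>auto simp: conj\<close>)
  finally show ?thesis by simp
qed

section \<open>From equal Gauss sums to a Galois automorphism\<close>

theorem proposition3p4:
  fixes p f q :: nat and \<zeta> :: complex
    and \<chi> \<chi>' :: "'a :: finite_field \<Rightarrow> complex"
  assumes "prime p" and "f \<ge> 2" and "q = p ^ f" and "CARD('a) = q"
    and "generates_roots_of_unity p \<zeta>"
    and "mult_char \<chi>" and "mult_char \<chi>'"
    and "char_order \<chi> = q - 1"
    and "gauss_sum \<zeta> \<chi> = gauss_sum \<zeta> \<chi>'"
  shows "frobenius_conjugate \<chi> \<chi>'"
proof -
  define n where "n = CARD('a) - 1"
  let ?U = "UNIV - {0 :: 'a}"
  have n: "n = q - 1" using assms(4) by (simp add: n_def)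
  have cU: "card ?U = n" by (simp add: n_def card_Diff_singleton)
  have char: "CHAR('a) = p" using CHAR_eq_if_CARD_prime_power[OF assms(1)] assms(3,4) by simp
  have p: "p \<ge> 2" using assms(1) prime_ge_2_nat by blast
  \<comment> \<open>This bound yields \<open>n > 1\<close>, so that \<chi> is nontrivial and its
    values sum to 0.\<close>
  have "(2::nat) ^ 2 \<le> 2 ^ f" using assms(2) by (intro power_increasing) auto
  also have "\<dots> \<le> q" unfolding assms(3) using p by (rule power_mono) simp
  finally have q: "q \<ge> 4" by simp
  then have n1: "n > 1" using n by simp
  have np: "coprime n p"
  proof -
    have "coprime (q - 1) q" using q by (intro coprime_diff_one_left_nat) simp
    then show ?thesis using assms(2,3) n by simp
  qed
  have n_char: "(of_nat n :: 'a) = -1"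
  proof -
    have "n + 1 = p ^ f" using n q assms(3) by simp
    then have "CHAR('a) dvd n + 1" using char assms(2) by simp
    then have "(of_nat (n + 1) :: 'a) = 0" by (simp only: of_nat_eq_0_iff_char_dvd)
    then show ?thesis by (simp add: eq_neg_iff_add_eq_0 add.commute)
  qed
  obtain g :: 'a where g: "g \<noteq> 0" "\<And>a. a \<noteq> 0 \<Longrightarrow> \<exists>i. a = g ^ i"
    by (rule finite_field_mult_group_cyclic) blast
  have ord_g: "has_mult_order n g" unfolding n_def by (rule has_mult_order_generator[OF g])
  then have ord_g': "has_mult_order n (inverse g)"
    by (simp add: has_mult_order_def power_inverse)
  obtain e where e: "a = g ^ e a" if "a \<noteq> 0" for a using g(2) by metis
  define r where "r a = residue_rep (field_trace a)" for a :: 'a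
  have r: "r a < p" "of_nat (r a) = field_trace a" for a
    using residue_rep[OF field_trace_in_prime_subfield[of a]] by (auto simp: r_def char)
  have hom_power: "X (a ^ i) = X a ^ i" if "mult_char X" "a \<noteq> 0" for X :: "'a \<Rightarrow> complex" and a i
  proof (induction i)
    case 0
    \<comment> \<open>\<open>X 1\<close> is idempotent, and nonzero as a root of unity, hence
      1.\<close>
    have "X (1 * 1) = X 1 * X 1" using that(1) unfolding mult_char_def by (metis one_neq_zero)
    moreover have "X 1 ^ n = 1" using that(1) by (simp add: mult_char_def roots_of_unity_def n_def)
    ultimately have "X 1 = 1" using n1 by (cases "X 1 = 0") (auto simp: power_0_left)
    then show ?case by simp
  qed (use that in \<open>simp add: mult_char_def\<close>)
  define w where "w = \<chi> g"
  have rou: "\<chi> a ^ n = 1" "\<chi>' a ^ n = 1" if "a \<noteq> 0" for a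
    using assms(6,7) that by (auto simp: mult_char_def roots_of_unity_def n_def)
  have ord_w: "has_mult_order n w"
  proof (rule has_mult_orderI)
    fix k assume k: "0 < k" "k < n"
    show "w ^ k \<noteq> 1"
    proof
      assume wk: "w ^ k = 1"
      have "\<chi> a ^ k = 1" if "a \<noteq> 0" for a
      proof -
        have "\<chi> a = w ^ e a" using e[OF that] hom_power[OF assms(6) g(1)] by (metis w_def)
        then show ?thesis using wk by (metis power_mult mult.commute power_one)
      qed
      then have "char_order \<chi> \<le> k" unfolding char_order_def using k by (intro Least_le) auto
      then show False using k assms(8) n by simp
    qed
  qed (use rou g n1 in \<open>auto simp: w_def\<close>)
  have "\<exists>b. \<chi>' g = w ^ b"
  proof -
    \<comment> \<open>By counting, the powers of \<open>w\<close> exhaust the \<open>n\<close>-th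
      roots of unity.\<close>
    have "(^) w ` {..<n} = {z. z ^ n = 1}"
    proof (rule card_seteq)
      show "finite {z::complex. z ^ n = 1}" using n1 by (intro finite_roots_unity) simp
      show "(^) w ` {..<n} \<subseteq> {z. z ^ n = 1}"
        using has_mult_order_power_eq_1_iff[OF ord_w] by (auto simp flip: power_mult)
      show "card {z::complex. z ^ n = 1} \<le> card ((^) w ` {..<n})"
        using n1 has_mult_order_inj_on[OF ord_w]
        by (simp add: card_image card_roots_unity_eq)
    qed
    then show ?thesis using rou(2)[OF g(1)] by blast
  qed
  then obtain b where b: "\<chi>' g = w ^ b" by blast
  have chi: "\<chi> a = w ^ e a" "\<chi>' a = w ^ (b * e a)" if "a \<noteq> 0" for a
    using e[OF that] hom_power[OF assms(6) g(1)] hom_power[OF assms(7) g(1)]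
    by (metis w_def, metis b power_mult)
  have "(\<Sum>a\<in>?U. (w ^ e a - w ^ (b * e a)) * \<zeta> ^ r a) = gauss_sum \<zeta> \<chi> - gauss_sum \<zeta> \<chi>'"
    unfolding gauss_sum_def sum_subtractf[symmetric]
    by (rule sum.cong) (auto simp: chi add_char_def r_def algebra_simps)
  then have fibre: "of_nat p * (\<Sum>a\<in>{a\<in>?U. r a = j}. w ^ e a - w ^ (b * e a))
      = (\<Sum>a\<in>?U. w ^ e a - w ^ (b * e a))" if "j < p" for j
    using fibre_sums_eq_if_weighted_sum_eq_0[OF ord_w _
        has_mult_order_if_generates_roots_of_unity[OF assms(1,5)] assms(1) np,
        of ?U r e "\<lambda>a. b * e a"] that r n1 assms(9) by simp
  have "(\<Sum>a\<in>?U. \<chi> a) = 0"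
  proof (rule sum_nontrivial_hom_eq_0[of _ g])
    show "\<chi> g \<noteq> 1"
      using has_mult_order_power_eq_1_iff[OF ord_w, of 1] n1 by (simp add: w_def)
  qed (use assms(6) g(1) in \<open>auto simp: mult_char_def\<close>)
  then have total: "(\<Sum>a\<in>?U. w ^ e a - w ^ (b * e a)) = - (\<Sum>a\<in>?U. \<chi>' a)"
    by (simp add: sum_subtractf chi flip: chi)
  \<comment> \<open>At \<open>w\<close> this is the difference of the two fibre sums over trace
    \<open>j\<close>; at \<open>inverse g\<close> it is its image in the finite field.\<close>
  define P where "P j = (\<Sum>a\<in>{a\<in>?U. r a = j}. monom (1::int) (e a) - monom 1 (b * e a))" for j
  \<comment> \<open>A trivial \<chi>' is impossible: it gives p P_0(w) + n = 0, whose image in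
    characteristic p reads n = 0, whereas n = -1 there.\<close>
  have "(\<Sum>a\<in>?U. \<chi>' a) = 0"
  proof (cases "\<chi>' g = 1")
    case True
    have "\<chi>' a = 1" if "a \<noteq> 0" for a
      using e[OF that] hom_power[OF assms(7) g(1)] True by (metis power_one)
    then have "(\<Sum>a\<in>?U. \<chi>' a) = of_nat n" using cU by simp
    then have "int_poly_eval ([:int p:] * P 0 + [:int n:]) w = 0"
      using fibre[of 0] total p by (simp add: P_def)
    then have "int_poly_eval ([:int p:] * P 0 + [:int n:]) g = 0"
      by (rule int_poly_eval_transfer[OF ord_w ord_g, rotated]) (use n1 in simp)
    moreover have "(of_nat p :: 'a) = 0" using char by (metis of_nat_CHAR)
    ultimately have "(of_nat n :: 'a) = 0" by simp
    then show ?thesis using n_char by simp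
  next
    case False
    then show ?thesis
      using assms(7) g(1) by (intro sum_nontrivial_hom_eq_0[of _ g]) (auto simp: mult_char_def)
  qed
  then have "int_poly_eval (P j) w = 0" if "j < p" for j
    using fibre[OF that] total p by (simp add: P_def)
  then have fibre': "int_poly_eval (P j) (inverse g) = 0" if "j < p" for j
    using int_poly_eval_transfer[OF ord_w ord_g'] n1 that by simp
  define d where "d a = inverse a - inverse a ^ b" for a :: 'a
  have d: "int_poly_eval (P j) (inverse g) = (\<Sum>a\<in>{a\<in>?U. r a = j}. d a)" for j
  proof -
    have "inverse g ^ e a - inverse g ^ (b * e a) = d a" if "a \<noteq> 0" for a
    proof -
      have "inverse g ^ e a = inverse a" using e[OF that] by (metis power_inverse)
      then show ?thesis by (simp add: d_def mult.commute[of b] power_mult)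
    qed
    then show ?thesis by (simp add: P_def)
  qed
  \<comment> \<open>On the fibre \<open>r a = j\<close> the trace is \<open>j\<close>, so the
    vanishing fibre sums kill the trace-weighted sum.\<close>
  have "(\<Sum>a\<in>?U. d a * field_trace a) = (\<Sum>j<p. \<Sum>a\<in>{a\<in>?U. r a = j}. d a * field_trace a)"
    by (rule sum.group[symmetric]) (use r in auto)
  also have "\<dots> = (\<Sum>j<p. of_nat j * (\<Sum>a\<in>{a\<in>?U. r a = j}. d a))"
    unfolding sum_distrib_left by (intro sum.cong) (auto simp flip: r(2))
  also have "\<dots> = 0" using fibre' by (intro sum.neutral) (simp add: d)
  finally have "(\<Sum>a\<in>?U. \<Sum>\<sigma>\<in>galois_group. d a * \<sigma> a) = 0"
    by (simp add: field_trace_def sum_distrib_left)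
  then have "(\<Sum>\<sigma>\<in>galois_group. \<Sum>a\<in>?U. d a * \<sigma> a) = 0" by (subst sum.swap)
  then have "(\<Sum>\<sigma>\<in>galois_group. \<Sum>a\<in>?U. inverse a ^ b * \<sigma> a)
      = (\<Sum>\<sigma>\<in>galois_group. \<Sum>a\<in>?U. inverse a * \<sigma> a)"
    by (simp add: d_def left_diff_distrib sum_subtractf)
  \<comment> \<open>For \<sigma> other than the identity, \<sigma>(a)/a is a nontrivial homomorphism
    and sums to 0.\<close>
  also have "\<dots> = (\<Sum>\<sigma>\<in>{id}. \<Sum>a\<in>?U. inverse a * \<sigma> a)"
  proof (rule sum.mono_neutral_right)
    show "{id} \<subseteq> (galois_group :: ('a \<Rightarrow> 'a) set)" by (simp add: galois_group_def)
    show "\<forall>\<sigma>\<in>galois_group - {id}. (\<Sum>a\<in>?U. inverse a * \<sigma> a) = 0"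
    proof
      fix \<sigma> :: "'a \<Rightarrow> 'a" assume \<sigma>: "\<sigma> \<in> galois_group - {id}"
      then obtain c where c: "\<sigma> c \<noteq> c" by fastforce
      have "\<sigma> (0 + 0) = \<sigma> 0 + \<sigma> 0" using \<sigma> unfolding galois_group_def by blast
      then have "\<sigma> 0 = 0" by (simp only: add_0_right add_cancel_right_left)
      with c have "c \<noteq> 0" by auto
      with c have "inverse c * \<sigma> c \<noteq> 1" by (simp add: field_simps)
      with \<open>c \<noteq> 0\<close> \<sigma> show "(\<Sum>a\<in>?U. inverse a * \<sigma> a) = 0"
        by (intro sum_nontrivial_hom_eq_0[of _ c]) (auto simp: galois_group_def)
    qed
  qed simp
  also have "\<dots> = of_nat n" using cU by simp
  also have "\<dots> \<noteq> 0" using n_char by simp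
  finally obtain \<sigma> :: "'a \<Rightarrow> 'a" where \<sigma>: "\<sigma> \<in> galois_group"
    "(\<Sum>a\<in>?U. inverse a ^ b * \<sigma> a) \<noteq> 0"
    by (meson sum.neutral)
  \<comment> \<open>The nonzero sum forces the homomorphism a^(-b) \<sigma>(a) to be
    trivial.\<close>
  have \<sigma>_power: "\<sigma> c = c ^ b" if "c \<noteq> 0" for c
  proof -
    have "inverse c ^ b * \<sigma> c = 1"
    proof (rule ccontr)
      assume "inverse c ^ b * \<sigma> c \<noteq> 1"
      with that \<sigma>(1) have "(\<Sum>a\<in>?U. inverse a ^ b * \<sigma> a) = 0"
        by (intro sum_nontrivial_hom_eq_0[of _ c]) (auto simp: galois_group_def power_mult_distrib)
      with \<sigma>(2) show False by contradiction
    qed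
    then show ?thesis using that by (simp add: field_simps)
  qed
  have "\<chi>' a = \<chi> (\<sigma> a)" if "a \<noteq> 0" for a
    using that chi hom_power[OF assms(6) that] by (simp add: \<sigma>_power mult.commute flip: power_mult)
  then show ?thesis unfolding frobenius_conjugate_def using \<sigma>(1) by blast
qed

end
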